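(* There are exactly $43$ semigroups contained in the monoid $\mathbb{M}$ of Kuratowski operations that are not monoids (i.e. have no two-sided identity of their own). They are the following. (1) $\langle\sigma_2,\sigma_3\rangle=\{\sigma_2,\sigma_3,\sigma_6,\sigma_7,\sigma_{10},\sigma_{11}\}$. (2) $\langle\sigma_2,\sigma_3,\sigma_5\rangle=\{\sigma_2,\sigma_3,\sigma_5,\sigma_6,\ldots,\sigma_{13}\}$. (3) $\langle\sigma_2,\sigma_3,\sigma_8\rangle=\langle\sigma_2,\sigma_3,\sigma_9\rangle=\langle\sigma_2,\sigma_3,\sigma_{12}\rangle=\langle\sigma_2,\sigma_3,\sigma_{13}\rangle=\{\sigma_2,\sigma_3,\sigma_6,\sigma_7,\ldots,\sigma_{13}\}$. (4) $\langle\sigma_2,\sigma_4\rangle=\{\sigma_2,\sigma_4,\sigma_6,\sigma_8,\sigma_{10},\sigma_{12}\}$. (5) $\langle\sigma_2,\sigma_4,\sigma_5\rangle=\{\sigma_2,\sigma_4,\sigma_5,\sigma_6,\ldots,\sigma_{13}\}$. (6) $\langle\sigma_2,\sigma_4,\sigma_7\rangle=\langle\sigma_2,\sigma_4,\sigma_9\rangle=\langle\sigma_2,\sigma_4,\sigma_{11}\rangle=\langle\sigma_2,\sigma_4,\sigma_{13}\rangle=\{\sigma_2,\sigma_4,\sigma_6,\sigma_7,\ldots,\sigma_{13}\}$. (7) $\langle\sigma_2,\sigma_5\rangle=\{\sigma_2,\sigma_5,\sigma_7,\sigma_8,\sigma_{10},\sigma_{13}\}$. (8) $\langle\sigma_2,\sigma_5,\sigma_6\rangle=\langle\sigma_2,\sigma_5,\sigma_9\rangle=\langle\sigma_2,\sigma_5,\sigma_{11}\rangle=\langle\sigma_2,\sigma_5,\sigma_{12}\rangle=\{\sigma_2,\sigma_5,\sigma_6,\ldots,\sigma_{13}\}$.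 (9) $\langle\sigma_2,\sigma_7\rangle=\{\sigma_2,\sigma_7,\sigma_{10}\}$. (10) $\langle\sigma_2,\sigma_8\rangle=\{\sigma_2,\sigma_8,\sigma_{10}\}$. (11) $\langle\sigma_2,\sigma_9\rangle=\langle\sigma_2,\sigma_6,\sigma_{13}\rangle=\langle\sigma_2,\sigma_7,\sigma_{12}\rangle=\langle\sigma_2,\sigma_8,\sigma_{11}\rangle=\langle\sigma_2,\sigma_{11},\sigma_{12}\rangle=\langle\sigma_2,\sigma_{11},\sigma_{13}\rangle=\langle\sigma_2,\sigma_{12},\sigma_{13}\rangle=\{\sigma_2,\sigma_6,\sigma_7,\ldots,\sigma_{13}\}$. (12) $\langle\sigma_2,\sigma_{11}\rangle=\langle\sigma_2,\sigma_6,\sigma_7\rangle=\{\sigma_2,\sigma_6,\sigma_7,\sigma_{10},\sigma_{11}\}$. (13) $\langle\sigma_2,\sigma_{12}\rangle=\langle\sigma_2,\sigma_6,\sigma_8\rangle=\{\sigma_2,\sigma_6,\sigma_8,\sigma_{10},\sigma_{12}\}$. (14) $\langle\sigma_2,\sigma_{13}\rangle=\langle\sigma_2,\sigma_7,\sigma_8\rangle=\{\sigma_2,\sigma_7,\sigma_8,\sigma_{10},\sigma_{13}\}$. (15) $\langle\sigma_3\rangle=\{\sigma_3,\sigma_7,\sigma_{11}\}$. (16) $\langle\sigma_3,\sigma_4\rangle=\{\sigma_2,\sigma_3,\ldots,\sigma_{13}\}$. (17) $\langle\sigma_3,\sigma_5\rangle=\{\sigma_3,\sigma_5,\sigma_7,\sigma_9,\sigma_{11},\sigma_{13}\}$.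 (18) $\langle\sigma_3,\sigma_5,\sigma_6\rangle=\langle\sigma_3,\sigma_5,\sigma_8\rangle=\langle\sigma_3,\sigma_5,\sigma_{10}\rangle=\langle\sigma_3,\sigma_5,\sigma_{12}\rangle=\{\sigma_3,\sigma_5,\sigma_6,\ldots,\sigma_{13}\}$. (19) $\langle\sigma_3,\sigma_6\rangle=\langle\sigma_3,\sigma_{10}\rangle=\{\sigma_3,\sigma_6,\sigma_7,\sigma_{10},\sigma_{11}\}$. (20) $\langle\sigma_3,\sigma_8\rangle=\langle\sigma_3,\sigma_{12}\rangle=\{\sigma_3,\sigma_6,\sigma_7,\ldots,\sigma_{13}\}$. (21) $\langle\sigma_3,\sigma_9\rangle=\langle\sigma_3,\sigma_{13}\rangle=\{\sigma_3,\sigma_7,\sigma_9,\sigma_{11},\sigma_{13}\}$. (22) $\langle\sigma_4\rangle=\{\sigma_4,\sigma_8,\sigma_{12}\}$. (23) $\langle\sigma_4,\sigma_5\rangle=\{\sigma_4,\sigma_5,\sigma_8,\sigma_9,\sigma_{12},\sigma_{13}\}$. (24) $\langle\sigma_4,\sigma_5,\sigma_6\rangle=\langle\sigma_4,\sigma_5,\sigma_7\rangle=\langle\sigma_4,\sigma_5,\sigma_{10}\rangle=\langle\sigma_4,\sigma_5,\sigma_{11}\rangle=\{\sigma_4,\sigma_5,\ldots,\sigma_{13}\}$. (25) $\langle\sigma_4,\sigma_6\rangle=\langle\sigma_4,\sigma_{10}\rangle=\{\sigma_4,\sigma_6,\sigma_8,\sigma_{10},\sigma_{12}\}$. (26) $\langle\sigma_4,\sigma_7\rangle=\langle\sigma_4,\sigma_{11}\rangle=\{\sigma_4,\sigma_6,\sigma_7,\ldots,\sigma_{13}\}$.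 (27) $\langle\sigma_4,\sigma_9\rangle=\langle\sigma_4,\sigma_{13}\rangle=\{\sigma_4,\sigma_8,\sigma_9,\sigma_{12},\sigma_{13}\}$. (28) $\langle\sigma_5,\sigma_6\rangle=\langle\sigma_5,\sigma_7,\sigma_{12}\rangle=\langle\sigma_5,\sigma_8,\sigma_{11}\rangle=\langle\sigma_5,\sigma_9,\sigma_{10}\rangle=\langle\sigma_5,\sigma_{10},\sigma_{11}\rangle=\langle\sigma_5,\sigma_{10},\sigma_{12}\rangle=\langle\sigma_5,\sigma_{11},\sigma_{12}\rangle=\{\sigma_5,\sigma_6,\ldots,\sigma_{13}\}$. (29) $\langle\sigma_5,\sigma_7\rangle=\{\sigma_5,\sigma_7,\sigma_{13}\}$. (30) $\langle\sigma_5,\sigma_8\rangle=\{\sigma_5,\sigma_8,\sigma_{13}\}$. (31) $\langle\sigma_5,\sigma_{10}\rangle=\langle\sigma_5,\sigma_7,\sigma_8\rangle=\{\sigma_5,\sigma_7,\sigma_8,\sigma_{10},\sigma_{13}\}$. (32) $\langle\sigma_5,\sigma_{11}\rangle=\langle\sigma_5,\sigma_7,\sigma_9\rangle=\{\sigma_5,\sigma_7,\sigma_9,\sigma_{11},\sigma_{13}\}$. (33) $\langle\sigma_5,\sigma_{12}\rangle=\langle\sigma_5,\sigma_8,\sigma_9\rangle=\{\sigma_5,\sigma_8,\sigma_9,\sigma_{12},\sigma_{13}\}$. (34) $\langle\sigma_6,\sigma_7\rangle=\langle\sigma_6,\sigma_{11}\rangle=\langle\sigma_{10},\sigma_{11}\rangle=\{\sigma_6,\sigma_7,\sigma_{10},\sigma_{11}\}$.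 (35) $\langle\sigma_6,\sigma_8\rangle=\langle\sigma_6,\sigma_{12}\rangle=\langle\sigma_{10},\sigma_{12}\rangle=\{\sigma_6,\sigma_8,\sigma_{10},\sigma_{12}\}$. (36) $\langle\sigma_6,\sigma_9\rangle=\langle\sigma_6,\sigma_{13}\rangle=\langle\sigma_7,\sigma_{12}\rangle=\langle\sigma_8,\sigma_{11}\rangle=\langle\sigma_9,\sigma_{10}\rangle=\langle\sigma_{11},\sigma_{12}\rangle=\langle\sigma_6,\sigma_7,\sigma_8\rangle=\langle\sigma_7,\sigma_8,\sigma_9\rangle=\langle\sigma_{10},\sigma_{11},\sigma_{13}\rangle=\langle\sigma_{10},\sigma_{12},\sigma_{13}\rangle=\{\sigma_6,\sigma_7,\ldots,\sigma_{13}\}$. (37) $\langle\sigma_7,\sigma_8\rangle=\{\sigma_7,\sigma_8,\sigma_{10},\sigma_{13}\}$. (38) $\langle\sigma_7,\sigma_9\rangle=\{\sigma_7,\sigma_9,\sigma_{11},\sigma_{13}\}$. (39) $\langle\sigma_7,\sigma_{10}\rangle=\{\sigma_7,\sigma_{10}\}$. (40) $\langle\sigma_7,\sigma_{13}\rangle=\{\sigma_7,\sigma_{13}\}$. (41) $\langle\sigma_8,\sigma_9\rangle=\{\sigma_8,\sigma_9,\sigma_{12},\sigma_{13}\}$. (42) $\langle\sigma_8,\sigma_{10}\rangle=\{\sigma_8,\sigma_{10}\}$. (43) $\langle\sigma_8,\sigma_{13}\rangle=\{\sigma_8,\sigma_{13}\}$.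
   Context: The monoid $\mathbb{M}$ of all Kuratowski operations is the monoid with identity $\sigma_0$ generated by $\sigma_1$ (complement) and $\sigma_2$ (closure) subject to the relations $\sigma_1\circ\sigma_1=\sigma_0$, $\sigma_2\circ\sigma_2=\sigma_2$, $\sigma_2\circ\sigma_{12}=\sigma_6$, $\sigma_2\circ\sigma_{13}=\sigma_7$, where (writing products as compositions, the rightmost factor applied first) $\sigma_3=\sigma_2\sigma_1$, $\sigma_4=\sigma_1\sigma_2$, $\sigma_5=\sigma_1\sigma_2\sigma_1$, $\sigma_6=\sigma_2\sigma_1\sigma_2$, $\sigma_7=\sigma_2\sigma_1\sigma_2\sigma_1$, $\sigma_8=\sigma_1\sigma_2\sigma_1\sigma_2$, $\sigma_9=\sigma_1\sigma_2\sigma_1\sigma_2\sigma_1$, $\sigma_{10}=\sigma_2\sigma_1\sigma_2\sigma_1\sigma_2$, $\sigma_{11}=\sigma_2\sigma_1\sigma_2\sigma_1\sigma_2\sigma_1$, $\sigma_{12}=\sigma_1\sigma_2\sigma_1\sigma_2\sigma_1\sigma_2$, $\sigma_{13}=\sigma_1\sigma_2\sigma_1\sigma_2\sigma_1\sigma_2\sigma_1$. It has exactly the $14$ distinct elements $\sigma_0,\sigma_1,\ldots,\sigma_{13}$. A semigroup contained in $\mathbb{M}$ is a nonempty subset closed under composition; $\langle A,B,\ldots\rangle$ denotes the subsemigroup of $\mathbb{M}$ generated by $A,B,\ldots$ under composition. In the lists, $\sigma_i,\ldots,\sigma_{13}$ means all operations with consecutive indices from $i$ to $13$. *)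

theory Defs
  imports Complex_Main
begin

datatype kgen = Compl | Clos

text \<open>
  A product of operations is a composition whose rightmost factor is applied first; it is
  encoded as the word listing its factors from left to right. \<open>kword i\<close> is the word that defines
  the operation with index \<open>i\<close>, and is meaningful for \<open>i \<le> 13\<close> only.
\<close>

definition kword :: "nat \<Rightarrow> kgen list" where
  "kword i =
    [[],
     [Compl],
     [Clos],
     [Clos, Compl],
     [Compl, Clos],
     [Compl, Clos, Compl],
     [Clos, Compl, Clos],
     [Clos, Compl, Clos, Compl],
     [Compl, Clos, Compl, Clos],
     [Compl, Clos, Compl, Clos, Compl],
     [Clos, Compl, Clos, Compl, Clos],
     [Clos, Compl, Clos, Compl, Clos, Compl],
     [Compl, Clos, Compl, Clos, Compl, Clos],
     [Compl, Clos, Compl, Clos, Compl, Clos, Compl]] ! i"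

inductive kcong :: "kgen list \<Rightarrow> kgen list \<Rightarrow> bool" where
  compl_compl: "kcong (kword 1 @ kword 1) (kword 0)"
| clos_clos: "kcong (kword 2 @ kword 2) (kword 2)"
| clos_12: "kcong (kword 2 @ kword 12) (kword 6)"
| clos_13: "kcong (kword 2 @ kword 13) (kword 7)"
| refl: "kcong u u"
| sym: "kcong u v \<Longrightarrow> kcong v u"
| trans: "kcong u v \<Longrightarrow> kcong v w \<Longrightarrow> kcong u w"
| append: "kcong u u' \<Longrightarrow> kcong v v' \<Longrightarrow> kcong (u @ v) (u' @ v')"

lemma equivp_kcong: "equivp kcong"
  by (rule equivpI) (auto intro: reflpI sympI transpI kcong.refl kcong.sym kcong.trans)

quotient_type kuratowski = "kgen list" / kcong
  by (rule equivp_kcong)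

instantiation kuratowski :: monoid_mult
begin

lift_definition one_kuratowski :: kuratowski is "[]" .

lift_definition times_kuratowski :: "kuratowski \<Rightarrow> kuratowski \<Rightarrow> kuratowski" is "(@)"
  by (rule kcong.append)

instance
  by standard (transfer; simp add: kcong.refl)+

end

lift_definition kop :: "nat \<Rightarrow> kuratowski" (\<open>\<sigma>\<close>) is kword .

definition subsemigroup :: "'a::times set \<Rightarrow> bool" where
  "subsemigroup S \<longleftrightarrow> S \<noteq> {} \<and> (\<forall>x\<in>S. \<forall>y\<in>S. x * y \<in> S)"

text \<open>The identity need not be the identity of the ambient monoid.\<close>

definition has_identity :: "'a::times set \<Rightarrow> bool" where
  "has_identity S \<longleftrightarrow> (\<exists>e\<in>S. \<forall>x\<in>S. e * x = x \<and> x * e = x)"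

definition generated :: "'a::times set \<Rightarrow> 'a set" (\<open>\<langle>_\<rangle>\<close>) where
  "\<langle>A\<rangle> = subsemigroup hull A"

end

(*
  Sending a word w to the index of w in normal form amounts to letting w act on the index 0, where
  complement and closure act on {0,...,13} by left multiplication; the four relations hold for this
  action, so the fourteen operations are distinct and multiply by the resulting table kmul.
  Subsemigroups then become kmul-closed subsets of {0,...,13}, which are enumerated by a
  backtracking search that decides one index after the other.
*)

theory Submission
  imports Defs
begin

section \<open>The action of words on the fourteen indices\<close>

text \<open>Entry \<open>j\<close> is the index of the normal form of the generator times
  \<open>\<sigma> j\<close>. The last two closure entries, 6 and 7, encode the relations
  \<open>clos_12\<close> and \<open>clos_13\<close>.\<close>

fun gen_act :: "kgen \<Rightarrow> nat \<Rightarrow> nat" where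
  "gen_act Compl j = [1, 0, 4, 5, 2, 3, 8, 9, 6, 7, 12, 13, 10, 11] ! j"
| "gen_act Clos j = [2, 3, 2, 3, 6, 7, 6, 7, 10, 11, 10, 11, 6, 7] ! j"

definition word_act :: "kgen list \<Rightarrow> nat \<Rightarrow> nat" where
  "word_act w j = foldr gen_act w j"

text \<open>The action on 0 of \<open>kword i @ kword j\<close> is the action of
  \<open>kword i\<close> on \<open>j\<close>, since \<open>kword j\<close> takes 0 to
  \<open>j\<close>; this is the index of the product.\<close>

definition kmul :: "nat \<Rightarrow> nat \<Rightarrow> nat" where
  "kmul i j = word_act (kword i) j"

text \<open>Turns the bound into membership in an explicit list, so that facts evaluated by
  \<open>code_simp\<close> over all indices can be applied.\<close>

lemma less_14_iff: "j < 14 \<longleftrightarrow> j \<in> set [0..<14]" for j :: nat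
  by simp

lemma word_act_append: "word_act (u @ v) j = word_act u (word_act v j)"
  by (simp add: word_act_def)

lemma gen_act_less:
  assumes "j < 14"
  shows "gen_act g j < 14"
proof -
  have "\<forall>j\<in>set [0..<14]. gen_act Compl j < 14 \<and> gen_act Clos j < 14"
    by code_simp
  then show ?thesis
    using assms by (cases g) (simp_all only: less_14_iff)
qed

lemma word_act_less: "j < 14 \<Longrightarrow> word_act w j < 14"
  by (induction w) (simp_all add: word_act_def gen_act_less)

text \<open>The four relations are evaluated on all fourteen indices. The equivalence rules are
  immediate, and for \<open>append\<close> the bound \<open>word_act_less\<close> keeps the inner
  index where the hypothesis on the left factor applies.\<close>

lemma word_act_kcong:
  assumes "kcong u v" "j < 14"
  shows "word_act u j = word_act v j"
  using assms
proof (induction arbitrary: j)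
  case compl_compl
  have "\<forall>j\<in>set [0..<14]. word_act (kword 1 @ kword 1) j = word_act (kword 0) j"
    by code_simp
  then show ?case
    using compl_compl by (simp only: less_14_iff)
next
  case clos_clos
  have "\<forall>j\<in>set [0..<14]. word_act (kword 2 @ kword 2) j = word_act (kword 2) j"
    by code_simp
  then show ?case
    using clos_clos by (simp only: less_14_iff)
next
  case clos_12
  have "\<forall>j\<in>set [0..<14]. word_act (kword 2 @ kword 12) j = word_act (kword 6) j"
    by code_simp
  then show ?case
    using clos_12 by (simp only: less_14_iff)
next
  case clos_13
  have "\<forall>j\<in>set [0..<14]. word_act (kword 2 @ kword 13) j = word_act (kword 7) j"
    by code_simp
  then show ?case
    using clos_13 by (simp only: less_14_iff)
qed (simp_all add: word_act_append word_act_less)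

section \<open>Normal forms: the fourteen operations are distinct and exhaust the monoid\<close>

lemma kword_act_0: "i < 14 \<Longrightarrow> word_act (kword i) 0 = i"
proof -
  have "\<forall>i\<in>set [0..<14]. word_act (kword i) 0 = i"
    by code_simp
  then show "i < 14 \<Longrightarrow> word_act (kword i) 0 = i"
    by (simp only: less_14_iff)
qed

text \<open>Congruent words send 0 to the same index, and \<open>kword i\<close> sends 0 to
  \<open>i\<close>.\<close>

lemma inj_on_kop: "inj_on \<sigma> {..<14}"
proof (rule inj_onI)
  fix i j
  assume "i \<in> {..<14}" "j \<in> {..<14}" "\<sigma> i = \<sigma> j"
  then have "kcong (kword i) (kword j)"
    by (simp add: kop.abs_eq kuratowski.abs_eq_iff)
  from word_act_kcong[OF this, of 0] show "i = j"
    using \<open>i \<in> _\<close> \<open>j \<in> _\<close> by (simp add: kword_act_0)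
qed

text \<open>In each of the 28 cases the longer word is already a normal form, or its doubled first
  letter reduces by \<open>c\<close> or \<open>k\<close>, or one of the relations
  \<open>clos_12\<close> and \<open>clos_13\<close> applies.\<close>

lemma kcong_gen_act:
  assumes "j < 14"
  shows "kcong (g # kword j) (kword (gen_act g j))"
proof -
  have c: "kcong (Compl # Compl # v) v" for v
    using kcong.append[OF compl_compl refl[of v]] by (simp add: kword_def)
  have k: "kcong (Clos # Clos # v) (Clos # v)" for v
    using kcong.append[OF clos_clos refl[of v]] by (simp add: kword_def)
  have "j \<in> set [0..<14]"
    using assms by simp
  then show ?thesis
    using c c[of "[]"] k k[of "[]"] kcong.clos_12 kcong.clos_13
    by (cases g) (auto simp: upt_rec kword_def intro: kcong.refl)
qed

text \<open>Reduces a word to normal form from its right end, one generator at a time; this gives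
  surjectivity of \<open>\<sigma>\<close> and the product formula.\<close>

lemma kcong_word_act: "kcong w (kword (word_act w 0))"
proof (induction w)
  case Nil
  then show ?case by (simp add: word_act_def kword_def kcong.refl)
next
  case (Cons g w)
  have "kcong ([g] @ w) ([g] @ kword (word_act w 0))"
    using Cons by (intro kcong.append kcong.refl)
  moreover have "kcong (g # kword (word_act w 0)) (kword (gen_act g (word_act w 0)))"
    by (intro kcong_gen_act word_act_less) simp
  ultimately show ?case
    by (auto simp: word_act_def intro: kcong.trans)
qed

lemma kop_surj: "\<sigma> ` {..<14} = UNIV"
proof -
  have "x \<in> \<sigma> ` {..<14}" for x
  proof (induction x rule: kuratowski.abs_induct)
    case (1 w)
    have "abs_kuratowski w = \<sigma> (word_act w 0)"
      by (simp add: kop.abs_eq kuratowski.abs_eq_iff kcong_word_act)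
    then show ?case
      using word_act_less[of 0 w] by simp
  qed
  then show ?thesis by auto
qed

section \<open>Multiplication of indices, and subsemigroups as closed index sets\<close>

lemma kmul_less: "j < 14 \<Longrightarrow> kmul i j < 14"
  by (simp add: kmul_def word_act_less)

lemma kop_mult:
  assumes "j < 14"
  shows "\<sigma> i * \<sigma> j = \<sigma> (kmul i j)"
proof -
  have "kcong (kword i @ kword j) (kword (kmul i j))"
    using kcong_word_act[of "kword i @ kword j"] assms
    by (simp add: kmul_def word_act_append kword_act_0)
  then show ?thesis
    by (simp add: kop.abs_eq times_kuratowski.abs_eq kuratowski.abs_eq_iff)
qed

definition kclosed :: "nat set \<Rightarrow> bool" where
  "kclosed N \<longleftrightarrow> (\<forall>i\<in>N. \<forall>j\<in>N. kmul i j \<in> N)"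

text \<open>The bound confines the preimage to the range where \<open>\<sigma>\<close> is injective;
  by surjectivity nothing of \<open>S\<close> is lost.\<close>

definition indices :: "kuratowski set \<Rightarrow> nat set" where
  "indices S = {i. i < 14 \<and> \<sigma> i \<in> S}"

lemma kop_image_indices: "\<sigma> ` indices S = S"
  using kop_surj by (fastforce simp: indices_def)

lemma kclosed_indices:
  assumes "subsemigroup S"
  shows "kclosed (indices S)"
  using assms
  by (simp add: kclosed_def indices_def subsemigroup_def kmul_less kop_mult[symmetric])

lemma subsemigroup_kop_image:
  assumes "kclosed N" "N \<subseteq> {..<14}" "N \<noteq> {}"
  shows "subsemigroup (\<sigma> ` N)"
  using assms unfolding subsemigroup_def kclosed_def
  by (auto simp: kop_mult subset_iff)

text \<open>Injectivity of \<open>\<sigma>\<close> below 14 turns equations between operations into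
  equations between indices.\<close>

lemma has_identity_kop_image:
  assumes "N \<subseteq> {..<14}"
  shows "has_identity (\<sigma> ` N) \<longleftrightarrow> (\<exists>e\<in>N. \<forall>x\<in>N. kmul e x = x \<and> kmul x e = x)"
proof -
  have "\<sigma> e * \<sigma> x = \<sigma> x \<and> \<sigma> x * \<sigma> e = \<sigma> x \<longleftrightarrow> kmul e x = x \<and> kmul x e = x"
    if "e \<in> N" "x \<in> N" for e x
    using that assms by (auto simp: kop_mult kmul_less subset_iff inj_on_eq_iff[OF inj_on_kop])
  then show ?thesis
    unfolding has_identity_def by auto
qed

section \<open>Products reached from generators\<close>

text \<open>
  The elements reached from \<open>xs\<close> by left multiplication with \<open>gs\<close>, added to \<open>acc\<close>. The first
  argument is fuel: no claim depends on its being large enough.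
\<close>

primrec span :: "nat \<Rightarrow> nat list \<Rightarrow> nat list \<Rightarrow> nat list \<Rightarrow> nat list" where
  "span 0 gs xs acc = acc"
| "span (Suc n) gs xs acc = (case xs of [] \<Rightarrow> acc
     | x # xs \<Rightarrow> if x \<in> set acc then span n gs xs acc
        else span n gs (map (\<lambda>g. kmul g x) gs @ xs) (x # acc))"

text \<open>Every element added is a product of members of \<open>N\<close>. This upper bound serves
  twice: it keeps the search inside the set being sought, and it shows that listed generators
  produce nothing outside a semigroup containing them.\<close>

lemma span_subset:
  assumes "kclosed N" "set gs \<subseteq> N" "set xs \<subseteq> N" "set acc \<subseteq> N"
  shows "set (span n gs xs acc) \<subseteq> N"
  using assms(3,4)
proof (induction n arbitrary: xs acc)
  case (Suc n)
  show ?case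
  proof (cases xs)
    case (Cons x ys)
    then have "set (map (\<lambda>g. kmul g x) gs @ ys) \<subseteq> N"
      using Suc.prems assms(1,2) by (auto simp: kclosed_def)
    then show ?thesis
      using Suc.prems Cons by (simp add: Suc.IH)
  qed (use Suc.prems in simp)
qed simp

lemma subset_span: "set acc \<subseteq> set (span n gs xs acc)"
proof (induction n arbitrary: xs acc)
  case (Suc n)
  show ?case
  proof (cases xs)
    case (Cons x ys)
    then show ?thesis
      using Suc.IH[of acc ys] Suc.IH[of "x # acc" "map (\<lambda>g. kmul g x) gs @ ys"] by auto
  qed simp
qed simp

lemma Cons_in_span: "x \<in> set (span (Suc n) gs (x # xs) acc)"
proof (cases "x \<in> set acc")
  case True
  then show ?thesis using subset_span[of acc "Suc n" gs "x # xs"] by blast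
next
  case False
  then show ?thesis using subset_span[of "x # acc" n gs "map (\<lambda>g. kmul g x) gs @ xs"] by simp
qed

section \<open>Backtracking search for closed index sets\<close>

text \<open>
  Decides membership of the indices in turn: \<open>xs\<close> is the semigroup generated by the elements
  \<open>gs\<close> chosen so far and \<open>ex\<close> collects the excluded ones, so that a branch dies as soon as the
  generated semigroup meets \<open>ex\<close>.
\<close>

primrec closed_lists :: "nat list \<Rightarrow> nat list \<Rightarrow> nat list \<Rightarrow> nat list \<Rightarrow> nat list list" where
  "closed_lists [] gs xs ex = [xs]"
| "closed_lists (i # is) gs xs ex =
     (if i \<in> set xs then closed_lists is gs xs ex
      else closed_lists is gs xs (i # ex) @
       (let ys = span 60 (i # gs) (i # map (kmul i) xs) xs in
         if list_ex (\<lambda>x. x \<in> set ex) ys then [] else closed_lists is (i # gs) ys ex))"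

text \<open>Follow the branch that decides each index as \<open>N\<close> does. The list
  \<open>xs\<close> stays inside \<open>N\<close>, hence off \<open>ex\<close>, and once no index is
  left it also covers \<open>N\<close>. Only completeness is claimed; closure of the listed sets is
  checked in \<open>nonmonoids_valid\<close>.\<close>

lemma closed_lists_complete:
  assumes "kclosed N" "N \<subseteq> set is \<union> set xs" "set gs \<subseteq> N" "set xs \<subseteq> N" "set ex \<inter> N = {}"
  shows "\<exists>L\<in>set (closed_lists is gs xs ex). set L = N"
  using assms(2-)
proof (induction "is" arbitrary: gs xs ex)
  case Nil
  then show ?case by auto
next
  case (Cons i "is")
  show ?case
  proof (cases "i \<in> set xs")
    case True
    then have "\<exists>L\<in>set (closed_lists is gs xs ex). set L = N"
      using Cons.prems by (intro Cons.IH) auto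
    then show ?thesis
      using True by simp
  next
    case out: False
    show ?thesis
    proof (cases "i \<in> N")
      case False
      then have "\<exists>L\<in>set (closed_lists is gs xs (i # ex)). set L = N"
        using Cons.prems by (intro Cons.IH) auto
      then show ?thesis
        using out by auto
    next
      case True
      \<comment> \<open>If \<open>xs\<close> is closed under left multiplication by
        \<open>gs\<close>, the products still to be explored start from \<open>i\<close> and from
        \<open>i\<close> times members of \<open>xs\<close>; hence this initial worklist.\<close>
      define ys where "ys = span 60 (i # gs) (i # map (kmul i) xs) xs"
      have sub: "set ys \<subseteq> N"
        unfolding ys_def using True Cons.prems assms(1)
        by (intro span_subset) (auto simp: kclosed_def)
      have "i \<in> set ys"
        \<comment> \<open>\<open>Cons_in_span\<close> speaks of fuel \<open>Suc n\<close>, so 59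
          gives the fuel 60 of the search.\<close>
        using Cons_in_span[of i 59] by (simp add: ys_def)
      moreover have "set xs \<subseteq> set ys"
        unfolding ys_def by (rule subset_span)
      ultimately have "\<exists>L\<in>set (closed_lists is (i # gs) ys ex). set L = N"
        using True Cons.prems sub by (intro Cons.IH) auto
      \<comment> \<open>The branch is not pruned: \<open>ys\<close> lies in \<open>N\<close>, which
        is disjoint from \<open>ex\<close>.\<close>
      moreover have "\<not> list_ex (\<lambda>x. x \<in> set ex) ys"
        using sub Cons.prems by (auto simp: list_ex_iff)
      ultimately show ?thesis
        using out by (auto simp: ys_def[symmetric])
    qed
  qed
qed

section \<open>The forty-three index sets, checked by evaluation\<close>

text \<open>Executable form of the criterion in \<open>has_identity_kop_image\<close>.\<close>

definition has_identity_list :: "nat list \<Rightarrow> bool" where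
  "has_identity_list L \<longleftrightarrow> (\<exists>e\<in>set L. \<forall>x\<in>set L. kmul e x = x \<and> kmul x e = x)"

text \<open>Each semigroup without identity, paired with the generating sets listed for it.\<close>

definition nonmonoids :: "(nat list \<times> nat list list) list" where
  "nonmonoids =
    [([2, 3, 6, 7, 10, 11], [[2, 3]]),
     ([2, 3, 5, 6, 7, 8, 9, 10, 11, 12, 13], [[2, 3, 5]]),
     ([2, 3, 6, 7, 8, 9, 10, 11, 12, 13], [[2, 3, 8], [2, 3, 9], [2, 3, 12], [2, 3, 13]]),
     ([2, 4, 6, 8, 10, 12], [[2, 4]]),
     ([2, 4, 5, 6, 7, 8, 9, 10, 11, 12, 13], [[2, 4, 5]]),
     ([2, 4, 6, 7, 8, 9, 10, 11, 12, 13], [[2, 4, 7], [2, 4, 9], [2, 4, 11], [2, 4, 13]]),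
     ([2, 5, 7, 8, 10, 13], [[2, 5]]),
     ([2, 5, 6, 7, 8, 9, 10, 11, 12, 13], [[2, 5, 6], [2, 5, 9], [2, 5, 11], [2, 5, 12]]),
     ([2, 7, 10], [[2, 7]]),
     ([2, 8, 10], [[2, 8]]),
     ([2, 6, 7, 8, 9, 10, 11, 12, 13],
       [[2, 9], [2, 6, 13], [2, 7, 12], [2, 8, 11], [2, 11, 12], [2, 11, 13],
        [2, 12, 13]]),
     ([2, 6, 7, 10, 11], [[2, 11], [2, 6, 7]]),
     ([2, 6, 8, 10, 12], [[2, 12], [2, 6, 8]]),
     ([2, 7, 8, 10, 13], [[2, 13], [2, 7, 8]]),
     ([3, 7, 11], [[3]]),
     ([2, 3, 4, 5, 6, 7, 8, 9, 10, 11, 12, 13], [[3, 4]]),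
     ([3, 5, 7, 9, 11, 13], [[3, 5]]),
     ([3, 5, 6, 7, 8, 9, 10, 11, 12, 13], [[3, 5, 6], [3, 5, 8], [3, 5, 10], [3, 5, 12]]),
     ([3, 6, 7, 10, 11], [[3, 6], [3, 10]]),
     ([3, 6, 7, 8, 9, 10, 11, 12, 13], [[3, 8], [3, 12]]),
     ([3, 7, 9, 11, 13], [[3, 9], [3, 13]]),
     ([4, 8, 12], [[4]]),
     ([4, 5, 8, 9, 12, 13], [[4, 5]]),
     ([4, 5, 6, 7, 8, 9, 10, 11, 12, 13], [[4, 5, 6], [4, 5, 7], [4, 5, 10], [4, 5, 11]]),
     ([4, 6, 8, 10, 12], [[4, 6], [4, 10]]),
     ([4, 6, 7, 8, 9, 10, 11, 12, 13], [[4, 7], [4, 11]]),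
     ([4, 8, 9, 12, 13], [[4, 9], [4, 13]]),
     ([5, 6, 7, 8, 9, 10, 11, 12, 13],
       [[5, 6], [5, 7, 12], [5, 8, 11], [5, 9, 10], [5, 10, 11], [5, 10, 12],
        [5, 11, 12]]),
     ([5, 7, 13], [[5, 7]]),
     ([5, 8, 13], [[5, 8]]),
     ([5, 7, 8, 10, 13], [[5, 10], [5, 7, 8]]),
     ([5, 7, 9, 11, 13], [[5, 11], [5, 7, 9]]),
     ([5, 8, 9, 12, 13], [[5, 12], [5, 8, 9]]),
     ([6, 7, 10, 11], [[6, 7], [6, 11], [10, 11]]),
     ([6, 8, 10, 12], [[6, 8], [6, 12], [10, 12]]),
     ([6, 7, 8, 9, 10, 11, 12, 13],
       [[6, 9], [6, 13], [7, 12], [8, 11], [9, 10], [11, 12], [6, 7, 8], [7, 8, 9],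
        [10, 11, 13], [10, 12, 13]]),
     ([7, 8, 10, 13], [[7, 8]]),
     ([7, 9, 11, 13], [[7, 9]]),
     ([7, 10], [[7, 10]]),
     ([7, 13], [[7, 13]]),
     ([8, 9, 12, 13], [[8, 9]]),
     ([8, 10], [[8, 10]]),
     ([8, 13], [[8, 13]])]"

text \<open>Runs the whole search. The empty list comes from the branch excluding every index; the
  other results list elements in order of discovery and are sorted before lookup.\<close>

lemma closed_lists_nonmonoids:
  "\<forall>L\<in>set (closed_lists [0..<14] [] [] []).
    L = [] \<or> has_identity_list L \<or> sort L \<in> set (map fst nonmonoids)"
  by code_simp

text \<open>The converse check on the listed sets. Sortedness and distinctness make each list
  determined by its set, which the count relies on.\<close>

lemma nonmonoids_valid:
  "\<forall>L\<in>set (map fst nonmonoids).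
    L \<noteq> [] \<and> \<not> has_identity_list L \<and> sorted L \<and> distinct L
    \<and> (\<forall>i\<in>set L. i < 14 \<and> (\<forall>j\<in>set L. kmul i j \<in> set L))"
  by code_simp

text \<open>With \<open>G\<close> as both multipliers and initial worklist, \<open>span\<close>
  collects iterated products of members of \<open>G\<close>, so each member of \<open>L\<close> is
  exhibited as such a product.\<close>

lemma nonmonoids_generators:
  "\<forall>(L, Gs)\<in>set nonmonoids. \<forall>G\<in>set Gs.
    (\<forall>i\<in>set G. i \<in> set L) \<and> (\<forall>i\<in>set L. i \<in> set (span 60 G G []))"
  by code_simp

lemma distinct_nonmonoids:
  "distinct (map fst nonmonoids) \<and> length (map fst nonmonoids) = 43"
  by code_simp

section \<open>Back to Kuratowski operations\<close>

lemma nonmonoids_subset: "L \<in> set (map fst nonmonoids) \<Longrightarrow> set L \<subseteq> {..<14}"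
  using nonmonoids_valid by auto

lemma subsemigroup_nonmonoids:
  assumes "L \<in> set (map fst nonmonoids)"
  shows "subsemigroup (\<sigma> ` set L)"
  using assms nonmonoids_valid
  by (intro subsemigroup_kop_image nonmonoids_subset) (auto simp: kclosed_def)

lemma generated_nonmonoids:
  assumes "(L, Gs) \<in> set nonmonoids" "G \<in> set Gs"
  shows "\<langle>\<sigma> ` set G\<rangle> = \<sigma> ` set L"
  unfolding generated_def
proof (rule hull_unique)
  have L: "L \<in> set (map fst nonmonoids)"
    using assms(1) by force
  have G: "set G \<subseteq> set L" "set L \<subseteq> set (span 60 G G [])"
    using nonmonoids_generators assms by auto
  show "\<sigma> ` set G \<subseteq> \<sigma> ` set L"
    using G(1) by auto
  show "subsemigroup (\<sigma> ` set L)"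
    using L by (rule subsemigroup_nonmonoids)
  fix S
  assume S: "\<sigma> ` set G \<subseteq> S" "subsemigroup S"
  have "set G \<subseteq> indices S"
    using S(1) G(1) nonmonoids_subset[OF L] by (auto simp: indices_def)
  \<comment> \<open>Minimality: the index set of \<open>S\<close> is closed and contains
    \<open>G\<close>, so it contains the span of \<open>G\<close>, which covers
    \<open>L\<close>.\<close>
  then have "set L \<subseteq> indices S"
    using G(2) span_subset[OF kclosed_indices[OF S(2)], of G G "[]" 60] by auto
  then show "\<sigma> ` set L \<subseteq> S"
    using kop_image_indices by blast
qed

text \<open>Completeness of the search gives one inclusion, validity of the list the other.\<close>

lemma nonmonoid_subsemigroups:
  "{S :: kuratowski set. subsemigroup S \<and> \<not> has_identity S} =
    (\<lambda>L. \<sigma> ` set L) ` set (map fst nonmonoids)"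
proof (intro equalityI subsetI)
  fix S :: "kuratowski set"
  assume "S \<in> {S. subsemigroup S \<and> \<not> has_identity S}"
  then have S: "subsemigroup S" "\<not> has_identity S" by auto
  have ind: "indices S \<subseteq> {..<14}"
    by (auto simp: indices_def)
  then have "indices S \<subseteq> set [0..<14] \<union> set []"
    by auto
  \<comment> \<open>The search starts with nothing chosen and nothing excluded.\<close>
  then obtain L where L: "L \<in> set (closed_lists [0..<14] [] [] [])" "set L = indices S"
    using closed_lists_complete[OF kclosed_indices[OF S(1)], of "[0..<14]" "[]" "[]" "[]"]
    by (metis empty_subsetI inf_bot_left list.set(1))
  have "L \<noteq> []"
    using S(1) L(2) kop_image_indices[of S] by (auto simp: subsemigroup_def)
  moreover have "\<not> has_identity_list L"
    using S(2) has_identity_kop_image[OF ind] L(2)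
    by (simp add: has_identity_list_def kop_image_indices)
  ultimately have "sort L \<in> set (map fst nonmonoids)"
    using closed_lists_nonmonoids L(1) by blast
  moreover have "S = \<sigma> ` set (sort L)"
    using L(2) kop_image_indices by simp
  ultimately show "S \<in> (\<lambda>L. \<sigma> ` set L) ` set (map fst nonmonoids)"
    by blast
next
  fix S
  assume "S \<in> (\<lambda>L. \<sigma> ` set L) ` set (map fst nonmonoids)"
  then obtain L where L: "L \<in> set (map fst nonmonoids)" "S = \<sigma> ` set L"
    by blast
  moreover have "\<not> has_identity_list L"
    using nonmonoids_valid L(1) by blast
  ultimately show "S \<in> {S. subsemigroup S \<and> \<not> has_identity S}"
    using subsemigroup_nonmonoids[OF L(1)] has_identity_kop_image[OF nonmonoids_subset[OF L(1)]]
    by (simp add: has_identity_list_def)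
qed

text \<open>Equal images under \<open>\<sigma>\<close> force equal index sets, and sorted distinct
  lists with equal sets coincide; so the 43 distinct lists yield 43 semigroups.\<close>

lemma card_nonmonoid_subsemigroups:
  "card ((\<lambda>L. \<sigma> ` set L) ` set (map fst nonmonoids)) = 43"
proof -
  have "inj_on (\<lambda>L. \<sigma> ` set L) (set (map fst nonmonoids))"
  proof (rule inj_onI)
    fix K L
    assume KL: "K \<in> set (map fst nonmonoids)" "L \<in> set (map fst nonmonoids)"
      and "\<sigma> ` set K = \<sigma> ` set L"
    then have "set K = set L"
      using inj_on_image_eq_iff[OF inj_on_kop nonmonoids_subset nonmonoids_subset] by blast
    then show "K = L"
      using nonmonoids_valid KL by (blast intro: sorted_distinct_set_unique)
  qed
  then show ?thesis
    using distinct_nonmonoids distinct_card by (metis card_image)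
qed

theorem mainTheorem2:
  shows "card {S :: kuratowski set. subsemigroup S \<and> \<not> has_identity S} = 43
    \<and> {S :: kuratowski set. subsemigroup S \<and> \<not> has_identity S} =
      {\<sigma> ` {2, 3, 6, 7, 10, 11},
       \<sigma> ` {2, 3, 5, 6, 7, 8, 9, 10, 11, 12, 13},
       \<sigma> ` {2, 3, 6, 7, 8, 9, 10, 11, 12, 13},
       \<sigma> ` {2, 4, 6, 8, 10, 12},
       \<sigma> ` {2, 4, 5, 6, 7, 8, 9, 10, 11, 12, 13},
       \<sigma> ` {2, 4, 6, 7, 8, 9, 10, 11, 12, 13},
       \<sigma> ` {2, 5, 7, 8, 10, 13},
       \<sigma> ` {2, 5, 6, 7, 8, 9, 10, 11, 12, 13},
       \<sigma> ` {2, 7, 10},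
       \<sigma> ` {2, 8, 10},
       \<sigma> ` {2, 6, 7, 8, 9, 10, 11, 12, 13},
       \<sigma> ` {2, 6, 7, 10, 11},
       \<sigma> ` {2, 6, 8, 10, 12},
       \<sigma> ` {2, 7, 8, 10, 13},
       \<sigma> ` {3, 7, 11},
       \<sigma> ` {2, 3, 4, 5, 6, 7, 8, 9, 10, 11, 12, 13},
       \<sigma> ` {3, 5, 7, 9, 11, 13},
       \<sigma> ` {3, 5, 6, 7, 8, 9, 10, 11, 12, 13},
       \<sigma> ` {3, 6, 7, 10, 11},
       \<sigma> ` {3, 6, 7, 8, 9, 10, 11, 12, 13},
       \<sigma> ` {3, 7, 9, 11, 13},
       \<sigma> ` {4, 8, 12},
       \<sigma> ` {4, 5, 8, 9, 12, 13},
       \<sigma> ` {4, 5, 6, 7, 8, 9, 10, 11, 12, 13},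
       \<sigma> ` {4, 6, 8, 10, 12},
       \<sigma> ` {4, 6, 7, 8, 9, 10, 11, 12, 13},
       \<sigma> ` {4, 8, 9, 12, 13},
       \<sigma> ` {5, 6, 7, 8, 9, 10, 11, 12, 13},
       \<sigma> ` {5, 7, 13},
       \<sigma> ` {5, 8, 13},
       \<sigma> ` {5, 7, 8, 10, 13},
       \<sigma> ` {5, 7, 9, 11, 13},
       \<sigma> ` {5, 8, 9, 12, 13},
       \<sigma> ` {6, 7, 10, 11},
       \<sigma> ` {6, 8, 10, 12},
       \<sigma> ` {6, 7, 8, 9, 10, 11, 12, 13},
       \<sigma> ` {7, 8, 10, 13},
       \<sigma> ` {7, 9, 11, 13},
       \<sigma> ` {7, 10},
       \<sigma> ` {7, 13},
       \<sigma> ` {8, 9, 12, 13},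
       \<sigma> ` {8, 10},
       \<sigma> ` {8, 13}}
    \<and> \<langle>\<sigma> ` {2, 3}\<rangle> = \<sigma> ` {2, 3, 6, 7, 10, 11}
    \<and> \<langle>\<sigma> ` {2, 3, 5}\<rangle> = \<sigma> ` {2, 3, 5, 6, 7, 8, 9, 10, 11, 12, 13}
    \<and> \<langle>\<sigma> ` {2, 3, 8}\<rangle> = \<sigma> ` {2, 3, 6, 7, 8, 9, 10, 11, 12, 13}
    \<and> \<langle>\<sigma> ` {2, 3, 9}\<rangle> = \<sigma> ` {2, 3, 6, 7, 8, 9, 10, 11, 12, 13}
    \<and> \<langle>\<sigma> ` {2, 3, 12}\<rangle> = \<sigma> ` {2, 3, 6, 7, 8, 9, 10, 11, 12, 13}
    \<and> \<langle>\<sigma> ` {2, 3, 13}\<rangle> = \<sigma> ` {2, 3, 6, 7, 8, 9, 10, 11, 12, 13}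
    \<and> \<langle>\<sigma> ` {2, 4}\<rangle> = \<sigma> ` {2, 4, 6, 8, 10, 12}
    \<and> \<langle>\<sigma> ` {2, 4, 5}\<rangle> = \<sigma> ` {2, 4, 5, 6, 7, 8, 9, 10, 11, 12, 13}
    \<and> \<langle>\<sigma> ` {2, 4, 7}\<rangle> = \<sigma> ` {2, 4, 6, 7, 8, 9, 10, 11, 12, 13}
    \<and> \<langle>\<sigma> ` {2, 4, 9}\<rangle> = \<sigma> ` {2, 4, 6, 7, 8, 9, 10, 11, 12, 13}
    \<and> \<langle>\<sigma> ` {2, 4, 11}\<rangle> = \<sigma> ` {2, 4, 6, 7, 8, 9, 10, 11, 12, 13}
    \<and> \<langle>\<sigma> ` {2, 4, 13}\<rangle> = \<sigma> ` {2, 4, 6, 7, 8, 9, 10, 11, 12, 13}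
    \<and> \<langle>\<sigma> ` {2, 5}\<rangle> = \<sigma> ` {2, 5, 7, 8, 10, 13}
    \<and> \<langle>\<sigma> ` {2, 5, 6}\<rangle> = \<sigma> ` {2, 5, 6, 7, 8, 9, 10, 11, 12, 13}
    \<and> \<langle>\<sigma> ` {2, 5, 9}\<rangle> = \<sigma> ` {2, 5, 6, 7, 8, 9, 10, 11, 12, 13}
    \<and> \<langle>\<sigma> ` {2, 5, 11}\<rangle> = \<sigma> ` {2, 5, 6, 7, 8, 9, 10, 11, 12, 13}
    \<and> \<langle>\<sigma> ` {2, 5, 12}\<rangle> = \<sigma> ` {2, 5, 6, 7, 8, 9, 10, 11, 12, 13}
    \<and> \<langle>\<sigma> ` {2, 7}\<rangle> = \<sigma> ` {2, 7, 10}
    \<and> \<langle>\<sigma> ` {2, 8}\<rangle> = \<sigma> ` {2, 8, 10}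
    \<and> \<langle>\<sigma> ` {2, 9}\<rangle> = \<sigma> ` {2, 6, 7, 8, 9, 10, 11, 12, 13}
    \<and> \<langle>\<sigma> ` {2, 6, 13}\<rangle> = \<sigma> ` {2, 6, 7, 8, 9, 10, 11, 12, 13}
    \<and> \<langle>\<sigma> ` {2, 7, 12}\<rangle> = \<sigma> ` {2, 6, 7, 8, 9, 10, 11, 12, 13}
    \<and> \<langle>\<sigma> ` {2, 8, 11}\<rangle> = \<sigma> ` {2, 6, 7, 8, 9, 10, 11, 12, 13}
    \<and> \<langle>\<sigma> ` {2, 11, 12}\<rangle> = \<sigma> ` {2, 6, 7, 8, 9, 10, 11, 12, 13}
    \<and> \<langle>\<sigma> ` {2, 11, 13}\<rangle> = \<sigma> ` {2, 6, 7, 8, 9, 10, 11, 12, 13}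
    \<and> \<langle>\<sigma> ` {2, 12, 13}\<rangle> = \<sigma> ` {2, 6, 7, 8, 9, 10, 11, 12, 13}
    \<and> \<langle>\<sigma> ` {2, 11}\<rangle> = \<sigma> ` {2, 6, 7, 10, 11}
    \<and> \<langle>\<sigma> ` {2, 6, 7}\<rangle> = \<sigma> ` {2, 6, 7, 10, 11}
    \<and> \<langle>\<sigma> ` {2, 12}\<rangle> = \<sigma> ` {2, 6, 8, 10, 12}
    \<and> \<langle>\<sigma> ` {2, 6, 8}\<rangle> = \<sigma> ` {2, 6, 8, 10, 12}
    \<and> \<langle>\<sigma> ` {2, 13}\<rangle> = \<sigma> ` {2, 7, 8, 10, 13}
    \<and> \<langle>\<sigma> ` {2, 7, 8}\<rangle> = \<sigma> ` {2, 7, 8, 10, 13}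
    \<and> \<langle>\<sigma> ` {3}\<rangle> = \<sigma> ` {3, 7, 11}
    \<and> \<langle>\<sigma> ` {3, 4}\<rangle> = \<sigma> ` {2, 3, 4, 5, 6, 7, 8, 9, 10, 11, 12, 13}
    \<and> \<langle>\<sigma> ` {3, 5}\<rangle> = \<sigma> ` {3, 5, 7, 9, 11, 13}
    \<and> \<langle>\<sigma> ` {3, 5, 6}\<rangle> = \<sigma> ` {3, 5, 6, 7, 8, 9, 10, 11, 12, 13}
    \<and> \<langle>\<sigma> ` {3, 5, 8}\<rangle> = \<sigma> ` {3, 5, 6, 7, 8, 9, 10, 11, 12, 13}
    \<and> \<langle>\<sigma> ` {3, 5, 10}\<rangle> = \<sigma> ` {3, 5, 6, 7, 8, 9, 10, 11, 12, 13}
    \<and> \<langle>\<sigma> ` {3, 5, 12}\<rangle> = \<sigma> ` {3, 5, 6, 7, 8, 9, 10, 11, 12, 13}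
    \<and> \<langle>\<sigma> ` {3, 6}\<rangle> = \<sigma> ` {3, 6, 7, 10, 11}
    \<and> \<langle>\<sigma> ` {3, 10}\<rangle> = \<sigma> ` {3, 6, 7, 10, 11}
    \<and> \<langle>\<sigma> ` {3, 8}\<rangle> = \<sigma> ` {3, 6, 7, 8, 9, 10, 11, 12, 13}
    \<and> \<langle>\<sigma> ` {3, 12}\<rangle> = \<sigma> ` {3, 6, 7, 8, 9, 10, 11, 12, 13}
    \<and> \<langle>\<sigma> ` {3, 9}\<rangle> = \<sigma> ` {3, 7, 9, 11, 13}
    \<and> \<langle>\<sigma> ` {3, 13}\<rangle> = \<sigma> ` {3, 7, 9, 11, 13}
    \<and> \<langle>\<sigma> ` {4}\<rangle> = \<sigma> ` {4, 8, 12}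
    \<and> \<langle>\<sigma> ` {4, 5}\<rangle> = \<sigma> ` {4, 5, 8, 9, 12, 13}
    \<and> \<langle>\<sigma> ` {4, 5, 6}\<rangle> = \<sigma> ` {4, 5, 6, 7, 8, 9, 10, 11, 12, 13}
    \<and> \<langle>\<sigma> ` {4, 5, 7}\<rangle> = \<sigma> ` {4, 5, 6, 7, 8, 9, 10, 11, 12, 13}
    \<and> \<langle>\<sigma> ` {4, 5, 10}\<rangle> = \<sigma> ` {4, 5, 6, 7, 8, 9, 10, 11, 12, 13}
    \<and> \<langle>\<sigma> ` {4, 5, 11}\<rangle> = \<sigma> ` {4, 5, 6, 7, 8, 9, 10, 11, 12, 13}
    \<and> \<langle>\<sigma> ` {4, 6}\<rangle> = \<sigma> ` {4, 6, 8, 10, 12}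
    \<and> \<langle>\<sigma> ` {4, 10}\<rangle> = \<sigma> ` {4, 6, 8, 10, 12}
    \<and> \<langle>\<sigma> ` {4, 7}\<rangle> = \<sigma> ` {4, 6, 7, 8, 9, 10, 11, 12, 13}
    \<and> \<langle>\<sigma> ` {4, 11}\<rangle> = \<sigma> ` {4, 6, 7, 8, 9, 10, 11, 12, 13}
    \<and> \<langle>\<sigma> ` {4, 9}\<rangle> = \<sigma> ` {4, 8, 9, 12, 13}
    \<and> \<langle>\<sigma> ` {4, 13}\<rangle> = \<sigma> ` {4, 8, 9, 12, 13}
    \<and> \<langle>\<sigma> ` {5, 6}\<rangle> = \<sigma> ` {5, 6, 7, 8, 9, 10, 11, 12, 13}
    \<and> \<langle>\<sigma> ` {5, 7, 12}\<rangle> = \<sigma> ` {5, 6, 7, 8, 9, 10, 11, 12, 13}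
    \<and> \<langle>\<sigma> ` {5, 8, 11}\<rangle> = \<sigma> ` {5, 6, 7, 8, 9, 10, 11, 12, 13}
    \<and> \<langle>\<sigma> ` {5, 9, 10}\<rangle> = \<sigma> ` {5, 6, 7, 8, 9, 10, 11, 12, 13}
    \<and> \<langle>\<sigma> ` {5, 10, 11}\<rangle> = \<sigma> ` {5, 6, 7, 8, 9, 10, 11, 12, 13}
    \<and> \<langle>\<sigma> ` {5, 10, 12}\<rangle> = \<sigma> ` {5, 6, 7, 8, 9, 10, 11, 12, 13}
    \<and> \<langle>\<sigma> ` {5, 11, 12}\<rangle> = \<sigma> ` {5, 6, 7, 8, 9, 10, 11, 12, 13}
    \<and> \<langle>\<sigma> ` {5, 7}\<rangle> = \<sigma> ` {5, 7, 13}
    \<and> \<langle>\<sigma> ` {5, 8}\<rangle> = \<sigma> ` {5, 8, 13}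
    \<and> \<langle>\<sigma> ` {5, 10}\<rangle> = \<sigma> ` {5, 7, 8, 10, 13}
    \<and> \<langle>\<sigma> ` {5, 7, 8}\<rangle> = \<sigma> ` {5, 7, 8, 10, 13}
    \<and> \<langle>\<sigma> ` {5, 11}\<rangle> = \<sigma> ` {5, 7, 9, 11, 13}
    \<and> \<langle>\<sigma> ` {5, 7, 9}\<rangle> = \<sigma> ` {5, 7, 9, 11, 13}
    \<and> \<langle>\<sigma> ` {5, 12}\<rangle> = \<sigma> ` {5, 8, 9, 12, 13}
    \<and> \<langle>\<sigma> ` {5, 8, 9}\<rangle> = \<sigma> ` {5, 8, 9, 12, 13}
    \<and> \<langle>\<sigma> ` {6, 7}\<rangle> = \<sigma> ` {6, 7, 10, 11}
    \<and> \<langle>\<sigma> ` {6, 11}\<rangle> = \<sigma> ` {6, 7, 10, 11}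
    \<and> \<langle>\<sigma> ` {10, 11}\<rangle> = \<sigma> ` {6, 7, 10, 11}
    \<and> \<langle>\<sigma> ` {6, 8}\<rangle> = \<sigma> ` {6, 8, 10, 12}
    \<and> \<langle>\<sigma> ` {6, 12}\<rangle> = \<sigma> ` {6, 8, 10, 12}
    \<and> \<langle>\<sigma> ` {10, 12}\<rangle> = \<sigma> ` {6, 8, 10, 12}
    \<and> \<langle>\<sigma> ` {6, 9}\<rangle> = \<sigma> ` {6, 7, 8, 9, 10, 11, 12, 13}
    \<and> \<langle>\<sigma> ` {6, 13}\<rangle> = \<sigma> ` {6, 7, 8, 9, 10, 11, 12, 13}
    \<and> \<langle>\<sigma> ` {7, 12}\<rangle> = \<sigma> ` {6, 7, 8, 9, 10, 11, 12, 13}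
    \<and> \<langle>\<sigma> ` {8, 11}\<rangle> = \<sigma> ` {6, 7, 8, 9, 10, 11, 12, 13}
    \<and> \<langle>\<sigma> ` {9, 10}\<rangle> = \<sigma> ` {6, 7, 8, 9, 10, 11, 12, 13}
    \<and> \<langle>\<sigma> ` {11, 12}\<rangle> = \<sigma> ` {6, 7, 8, 9, 10, 11, 12, 13}
    \<and> \<langle>\<sigma> ` {6, 7, 8}\<rangle> = \<sigma> ` {6, 7, 8, 9, 10, 11, 12, 13}
    \<and> \<langle>\<sigma> ` {7, 8, 9}\<rangle> = \<sigma> ` {6, 7, 8, 9, 10, 11, 12, 13}
    \<and> \<langle>\<sigma> ` {10, 11, 13}\<rangle> = \<sigma> ` {6, 7, 8, 9, 10, 11, 12, 13}
    \<and> \<langle>\<sigma> ` {10, 12, 13}\<rangle> = \<sigma> ` {6, 7, 8, 9, 10, 11, 12, 13}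
    \<and> \<langle>\<sigma> ` {7, 8}\<rangle> = \<sigma> ` {7, 8, 10, 13}
    \<and> \<langle>\<sigma> ` {7, 9}\<rangle> = \<sigma> ` {7, 9, 11, 13}
    \<and> \<langle>\<sigma> ` {7, 10}\<rangle> = \<sigma> ` {7, 10}
    \<and> \<langle>\<sigma> ` {7, 13}\<rangle> = \<sigma> ` {7, 13}
    \<and> \<langle>\<sigma> ` {8, 9}\<rangle> = \<sigma> ` {8, 9, 12, 13}
    \<and> \<langle>\<sigma> ` {8, 10}\<rangle> = \<sigma> ` {8, 10}
    \<and> \<langle>\<sigma> ` {8, 13}\<rangle> = \<sigma> ` {8, 13}"
proof -
  have "\<forall>(L, Gs)\<in>set nonmonoids. \<forall>G\<in>set Gs. \<langle>\<sigma> ` set G\<rangle> = \<sigma> ` set L"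
    using generated_nonmonoids by blast
  \<comment> \<open>Over an explicit list, \<open>list_all\<close> unfolds to a conjunction with one
    equation per generating set, matching the form of the goal.\<close>
  then have gen: "list_all (\<lambda>(L, Gs). list_all (\<lambda>G. \<langle>\<sigma> ` set G\<rangle> = \<sigma> ` set L) Gs) nonmonoids"
    by (auto simp: list_all_iff)
  show ?thesis
    unfolding nonmonoid_subsemigroups card_nonmonoid_subsemigroups
    using gen
    \<comment> \<open>Expanding the list in both \<open>gen\<close> and the goal gives the same
      explicit sets of operations on each side.\<close>
    unfolding nonmonoids_def list.pred_inject prod.case list.map fst_conv list.set
      image_insert image_empty
    by (intro conjI refl) (simp_all only:)
qed

end
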